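(* Let $$P(q)=(q-\alpha)*(q-\beta)*(q-\gamma)$$ be a quaternionic polynomial of degree $3$, where $\alpha,\beta,\gamma\in\mathbb{H}$ satisfy $|\alpha|\le k$, $|\beta|\le k$, $|\gamma|\le k$. Put $$A(k)=\frac{-3k^{2}+\sqrt{9k^{4}-4(2-k^{3})\bigl((2-k^{3})k^{2}-3k^{3}\bigr)}}{2(2-k^{3})}.$$ If $\alpha+\beta+\gamma=0$ and at least one of the inequalities $|\alpha|\le A(k)$, $|\beta|\le A(k)$, $|\gamma|\le A(k)$ holds, then for $k\ge 1$, $$\|P'\|\ \ge\ \frac{3}{1+k^{3}}\,\|P\|.$$
   Context: $\mathbb{H}$ denotes the quaternions with the usual norm $|\cdot|$, and $k$ is a real number. Polynomials are unilateral quaternionic polynomials with coefficients on the right, $P(q)=\sum_{m=0}^{n}q^{m}a_m$ with $a_m\in\mathbb{H}$, regarded as functions of $q\in\mathbb{H}$. The product $*$ is the convolution product: for $P_1(q)=\sum_i q^{i}a_i$ and $P_2(q)=\sum_j q^{j}b_j$, $(P_1*P_2)(q)=\sum_{i,j}q^{i+j}a_ib_j$. The derivative of $P(q)=\sum_{m=0}^{n}q^{m}a_m$ is $P'(q)=\sum_{m=1}^{n}m\,q^{m-1}a_m$. The norm of a polynomial is $\|P\|=\max\{|P(q)|: q\in\mathbb{H},\ |q|\le 1\}=\max\{|P(q)|: q\in\mathbb{H},\ |q|=1\}$. *)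

theory Defs
  imports "HOL-Analysis.Analysis" "HOL-Library.Poly_Mapping"
begin

section \<open>Quaternions\<close>

datatype quat = Quat (qRe: real) (qIm: real) (qJm: real) (qKm: real)

lemma quat_eq_iff:
  "x = y \<longleftrightarrow> qRe x = qRe y \<and> qIm x = qIm y \<and> qJm x = qJm y \<and> qKm x = qKm y"
  by (cases x; cases y) simp

instantiation quat :: ring_1
begin

definition "0 = Quat 0 0 0 0"

definition "1 = Quat 1 0 0 0"

definition "x + y = Quat (qRe x + qRe y) (qIm x + qIm y) (qJm x + qJm y) (qKm x + qKm y)"

definition "- x = Quat (- qRe x) (- qIm x) (- qJm x) (- qKm x)"

definition "x - y = Quat (qRe x - qRe y) (qIm x - qIm y) (qJm x - qJm y) (qKm x - qKm y)"

definition "x * y = Quat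
  (qRe x * qRe y - qIm x * qIm y - qJm x * qJm y - qKm x * qKm y)
  (qRe x * qIm y + qIm x * qRe y + qJm x * qKm y - qKm x * qJm y)
  (qRe x * qJm y - qIm x * qKm y + qJm x * qRe y + qKm x * qIm y)
  (qRe x * qKm y + qIm x * qJm y - qJm x * qIm y + qKm x * qRe y)"

instance
  by standard
    (simp_all add: quat_eq_iff zero_quat_def one_quat_def plus_quat_def uminus_quat_def
      minus_quat_def times_quat_def algebra_simps)

end

lemma quat_sel_simps [simp]:
  "qRe 0 = 0" "qIm 0 = 0" "qJm 0 = 0" "qKm 0 = 0"
  "qRe 1 = 1" "qIm 1 = 0" "qJm 1 = 0" "qKm 1 = 0"
  "qRe (x + y) = qRe x + qRe y" "qIm (x + y) = qIm x + qIm y"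
  "qJm (x + y) = qJm x + qJm y" "qKm (x + y) = qKm x + qKm y"
  "qRe (- x) = - qRe x" "qIm (- x) = - qIm x" "qJm (- x) = - qJm x" "qKm (- x) = - qKm x"
  "qRe (x - y) = qRe x - qRe y" "qIm (x - y) = qIm x - qIm y"
  "qJm (x - y) = qJm x - qJm y" "qKm (x - y) = qKm x - qKm y"
  "qRe (x * y) = qRe x * qRe y - qIm x * qIm y - qJm x * qJm y - qKm x * qKm y"
  "qIm (x * y) = qRe x * qIm y + qIm x * qRe y + qJm x * qKm y - qKm x * qJm y"
  "qJm (x * y) = qRe x * qJm y - qIm x * qKm y + qJm x * qRe y + qKm x * qIm y"
  "qKm (x * y) = qRe x * qKm y + qIm x * qJm y - qJm x * qIm y + qKm x * qRe y"
  by (simp_all add: zero_quat_def one_quat_def plus_quat_def uminus_quat_def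
      minus_quat_def times_quat_def)

instantiation quat :: real_algebra_1
begin

definition "scaleR r x = Quat (r * qRe x) (r * qIm x) (r * qJm x) (r * qKm x)"

instance
  by standard (simp_all add: quat_eq_iff scaleR_quat_def algebra_simps)

end

lemma quat_sel_scaleR [simp]:
  "qRe (scaleR r x) = r * qRe x" "qIm (scaleR r x) = r * qIm x"
  "qJm (scaleR r x) = r * qJm x" "qKm (scaleR r x) = r * qKm x"
  by (simp_all add: scaleR_quat_def)

instantiation quat :: real_div_algebra
begin

definition "inverse x = scaleR (1 / ((qRe x)\<^sup>2 + (qIm x)\<^sup>2 + (qJm x)\<^sup>2 + (qKm x)\<^sup>2))
  (Quat (qRe x) (- qIm x) (- qJm x) (- qKm x))"

definition "x div y = x * inverse y" for x y :: quat

instance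
proof
  fix x y :: quat
  have nz: "(qRe x)\<^sup>2 + (qIm x)\<^sup>2 + (qJm x)\<^sup>2 + (qKm x)\<^sup>2 \<noteq> 0" if "x \<noteq> 0"
    using that by (auto simp: quat_eq_iff add_nonneg_eq_0_iff)
  have *: "x * Quat (qRe x) (- qIm x) (- qJm x) (- qKm x) =
        scaleR ((qRe x)\<^sup>2 + (qIm x)\<^sup>2 + (qJm x)\<^sup>2 + (qKm x)\<^sup>2) 1"
      "Quat (qRe x) (- qIm x) (- qJm x) (- qKm x) * x =
        scaleR ((qRe x)\<^sup>2 + (qIm x)\<^sup>2 + (qJm x)\<^sup>2 + (qKm x)\<^sup>2) 1"
    by (simp_all add: quat_eq_iff power2_eq_square)
  show "inverse x * x = 1" if "x \<noteq> 0"
    using nz[OF that] by (simp only: inverse_quat_def mult_scaleR_left * scaleR_scaleR) simp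
  show "x * inverse x = 1" if "x \<noteq> 0"
    using nz[OF that] by (simp only: inverse_quat_def mult_scaleR_right * scaleR_scaleR) simp
  show "x div y = x * inverse y"
    by (rule divide_quat_def)
  show "inverse (0 :: quat) = 0"
    by (simp add: quat_eq_iff inverse_quat_def)
qed

end

instantiation quat :: real_inner
begin

definition "inner x y = qRe x * qRe y + qIm x * qIm y + qJm x * qJm y + qKm x * qKm y"

definition "norm x = sqrt ((qRe x)\<^sup>2 + (qIm x)\<^sup>2 + (qJm x)\<^sup>2 + (qKm x)\<^sup>2)"

definition sgn_quat_def: "sgn x = x /\<^sub>R norm x" for x :: quat

definition dist_quat_def: "dist x y = norm (x - y)" for x y :: quat

definition uniformity_quat_def:
  "(uniformity :: (quat \<times> quat) filter) = (INF e\<in>{0 <..}. principal {(x, y). dist x y < e})"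

definition open_quat_def:
  "open (U :: quat set) \<longleftrightarrow> (\<forall>x\<in>U. eventually (\<lambda>(x', y). x' = x \<longrightarrow> y \<in> U) uniformity)"

instance
proof
  fix x y z :: quat and r :: real and U :: "quat set"
  show "inner x y = inner y x" "inner (x + y) z = inner x z + inner y z"
    "inner (scaleR r x) y = r * inner x y"
    by (simp_all add: inner_quat_def algebra_simps)
  show "0 \<le> inner x x"
    by (simp add: inner_quat_def)
  show "inner x x = 0 \<longleftrightarrow> x = 0"
    by (simp add: inner_quat_def quat_eq_iff add_nonneg_eq_0_iff)
  show "norm x = sqrt (inner x x)"
    by (simp add: inner_quat_def norm_quat_def power2_eq_square)
qed (rule sgn_quat_def dist_quat_def uniformity_quat_def open_quat_def)+

end

instance quat :: real_normed_div_algebra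
proof
  fix x y :: quat
  have "(a*e - b*f - c*g - d*h)\<^sup>2 + (a*f + b*e + c*h - d*g)\<^sup>2
      + (a*g - b*h + c*e + d*f)\<^sup>2 + (a*h + b*g - c*f + d*e)\<^sup>2
      = (a\<^sup>2 + b\<^sup>2 + c\<^sup>2 + d\<^sup>2) * (e\<^sup>2 + f\<^sup>2 + g\<^sup>2 + h\<^sup>2)" for a b c d e f g h :: real
    by algebra
  then show "norm (x * y) = norm x * norm y"
    by (simp only: norm_quat_def quat_sel_simps real_sqrt_mult)
qed

instantiation quat :: euclidean_space
begin

definition "Basis = {Quat 1 0 0 0, Quat 0 1 0 0, Quat 0 0 1 0, Quat 0 0 0 1}"

instance
proof
  show "(Basis :: quat set) \<noteq> {}" "finite (Basis :: quat set)"
    by (simp_all add: Basis_quat_def)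
  show "inner u v = (if u = v then 1 else 0)" if "u \<in> Basis" "v \<in> Basis" for u v :: quat
    using that unfolding Basis_quat_def by (elim insertE emptyE) (simp_all add: inner_quat_def)
  show "(\<forall>u\<in>Basis. inner x u = 0) \<longleftrightarrow> x = 0" for x :: quat
    unfolding Basis_quat_def quat_eq_iff[of x] by (simp add: inner_quat_def)
qed

end


section \<open>Unilateral quaternionic polynomials\<close>

text \<open>
  The library type \<open>poly\<close> has a product and an evaluation only over commutative
  coefficients. A unilateral polynomial is here its finitely supported sequence of
  coefficients; the product of \<open>poly_mapping\<close> is then exactly the convolution
  product, in which the indeterminate commutes with the coefficients.
\<close>

type_synonym qpoly = "nat \<Rightarrow>\<^sub>0 quat"

definition qvar :: qpoly where
  "qvar = Poly_Mapping.single 1 1"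

definition qconst :: "quat \<Rightarrow> qpoly" where
  "qconst a = Poly_Mapping.single 0 a"

definition qeval :: "qpoly \<Rightarrow> quat \<Rightarrow> quat" where
  "qeval P q = (\<Sum>m\<in>Poly_Mapping.keys P. q ^ m * Poly_Mapping.lookup P m)"

definition qderiv :: "qpoly \<Rightarrow> qpoly" where
  "qderiv P = (\<Sum>m\<in>Poly_Mapping.keys P - {0}. Poly_Mapping.single (m - 1) (of_nat m * Poly_Mapping.lookup P m))"

definition qnorm :: "qpoly \<Rightarrow> real" where
  "qnorm P = (SUP q\<in>cball 0 1. norm (qeval P q))"

lemma lookup_qpoly_mult:
  fixes P Q :: qpoly
  shows "Poly_Mapping.lookup (P * Q) n = (\<Sum>i\<le>n. Poly_Mapping.lookup P i * Poly_Mapping.lookup Q (n - i))"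
proof -
  have *: "Sum_any (\<lambda>j. Poly_Mapping.lookup Q j when n = i + j) = (if i \<le> n then Poly_Mapping.lookup Q (n - i) else 0)" for i
  proof (cases "i \<le> n")
    case True
    then have "(\<lambda>j. Poly_Mapping.lookup Q j when n = i + j) = (\<lambda>j. Poly_Mapping.lookup Q j when j = n - i)"
      by (auto simp: when_def fun_eq_iff)
    with True show ?thesis by (simp only: Sum_any_when_equal if_True)
  next
    case False
    then have "(\<lambda>j. Poly_Mapping.lookup Q j when n = i + j) = (\<lambda>j. 0)"
      by (auto simp: when_def fun_eq_iff)
    with False show ?thesis by (simp only: Sum_any.neutral if_False)
  qed
  have "Poly_Mapping.lookup (P * Q) n =
      Sum_any (\<lambda>i. Poly_Mapping.lookup P i * (if i \<le> n then Poly_Mapping.lookup Q (n - i) else 0))"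
    by (simp only: lookup_mult *)
  also have "\<dots> = (\<Sum>i\<le>n. Poly_Mapping.lookup P i * (if i \<le> n then Poly_Mapping.lookup Q (n - i) else 0))"
    by (rule Sum_any.expand_superset) (auto split: if_splits)
  finally show ?thesis by simp
qed

lemma lookup_qderiv: "Poly_Mapping.lookup (qderiv P) n = of_nat (Suc n) * Poly_Mapping.lookup P (Suc n)"
proof -
  have "Poly_Mapping.lookup (qderiv P) n =
      (\<Sum>m\<in>Poly_Mapping.keys P - {0}. if m = Suc n then of_nat (Suc n) * Poly_Mapping.lookup P (Suc n) else 0)"
    unfolding qderiv_def lookup_sum
    by (rule sum.cong) (auto simp: lookup_single when_def)
  also have "\<dots> = of_nat (Suc n) * Poly_Mapping.lookup P (Suc n)"
    by (auto simp: sum.delta in_keys_iff)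
  finally show ?thesis .
qed

lemma continuous_on_qeval: "continuous_on S (qeval P)"
  unfolding qeval_def by (intro continuous_intros)

text \<open>The supremum in \<^const>\<open>qnorm\<close> is a maximum.\<close>

lemma qnorm_attained:
  "\<exists>q. norm q \<le> 1 \<and> norm (qeval P q) = qnorm P \<and>
    (\<forall>p. norm p \<le> 1 \<longrightarrow> norm (qeval P p) \<le> qnorm P)"
proof -
  have "continuous_on (cball 0 1) (\<lambda>q. norm (qeval P q))"
    by (intro continuous_on_norm continuous_on_qeval)
  then obtain q where q: "q \<in> cball 0 1"
    "\<And>p. p \<in> cball 0 1 \<Longrightarrow> norm (qeval P p) \<le> norm (qeval P q)"
    using continuous_attains_sup[of "cball (0 :: quat) 1"] by force
  then have "qnorm P = norm (qeval P q)"
    unfolding qnorm_def by (intro cSup_eq_maximum) auto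
  with q show ?thesis by (intro exI[of _ q]) auto
qed


section \<open>The bound on the zeros\<close>

text \<open>
  The formula is transcribed literally and denotes a root of
  \<open>(2 - k^3) * x^2 + 3 * k^2 * x + (2 - k^3) * k^2 - 3 * k^3\<close> only where it is
  meaningful: at \<open>k^3 = 2\<close> the library conventions make it \<open>0\<close>, and for large \<open>k\<close>
  the radicand is negative and \<open>sqrt (- x) = - sqrt x\<close>.
\<close>

definition A_bound :: "real \<Rightarrow> real" where
  "A_bound k =
    (- 3 * k^2 + sqrt (9 * k^4 - 4 * (2 - k^3) * ((2 - k^3) * k^2 - 3 * k^3))) / (2 * (2 - k^3))"

end

theory Submission
  imports Defs
begin

text \<open>
  Since \<open>\<alpha> + \<beta> + \<gamma> = 0\<close>, the polynomial is \<open>q^3 + q B - C\<close> with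
  \<open>B = \<alpha> \<beta> + \<alpha> \<gamma> + \<beta> \<gamma>\<close> and \<open>C = \<alpha> \<beta> \<gamma>\<close>, so its norm is at most \<open>1 + |B| + |C|\<close>.
  Its derivative is \<open>3 q^2 + B\<close>, and because every unit quaternion is the square of a
  unit quaternion, \<open>q^2\<close> can be aligned with \<open>B\<close>: the norm of the derivative is at least
  \<open>3 + |B|\<close>. The theorem thus reduces to \<open>(2 - k^3) |B| + 3 |C| \<le> 3 k^3\<close>.

  If \<open>k^3 \<ge> 2\<close>, this is clear from \<open>|C| \<le> k^3\<close>. Otherwise let \<open>a \<le> A(k)\<close> be the norm of
  the small root. Then \<open>|C| \<le> a k^2\<close>, and the vanishing sum gives \<open>|B| \<le> k^2 + a^2\<close>: for
  example \<open>B = \<beta> \<gamma> - \<alpha>^2\<close> and \<open>B = \<alpha> \<beta> - \<gamma>^2\<close> if \<open>\<alpha>\<close> or \<open>\<gamma>\<close> is small. When it is the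
  middle root that is small, noncommutativity prevents such a formula; but two adjacent
  factors can be interchanged at the price of replacing their roots by quaternions of the
  same norms (lemma \<open>quat_linear_factors_swap\<close>), which moves the small root to the
  front. What is left, \<open>(2 - k^3) (k^2 + a^2) + 3 k^2 a \<le> 3 k^3\<close>, holds because \<open>A(k)\<close> is
  the larger root in \<open>a\<close> of the corresponding quadratic equation.
\<close>

section \<open>Square roots and interchange of linear factors in the quaternions\<close>

lemma quat_norm_sq: "(norm x)\<^sup>2 = (qRe x)\<^sup>2 + (qIm x)\<^sup>2 + (qJm x)\<^sup>2 + (qKm x)\<^sup>2" for x :: quat
  by (simp add: norm_quat_def)

text \<open>This is the real quadratic equation satisfied by a quaternion, with coefficients its
  reduced trace and norm. It lets the noncommutative identities below be derived by ring
  calculations.\<close>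

lemma quat_square: "x * x = (2 * qRe x) *\<^sub>R x - (norm x)\<^sup>2 *\<^sub>R 1" for x :: quat
  by (simp add: quat_eq_iff quat_norm_sq) (simp add: power2_eq_square)

text \<open>The bisector \<open>1 + u\<close> of the angle between \<open>1\<close> and \<open>u\<close> points in the direction of a
  square root of \<open>u\<close>; only \<open>u = - 1\<close>, where it vanishes, has to be treated apart.\<close>

lemma unit_quat_sqrt:
  fixes u :: quat
  assumes "norm u = 1"
  obtains q where "norm q = 1" "q\<^sup>2 = u"
proof (cases "u = - 1")
  case True
  show thesis
    by (rule that[of "Quat 0 1 0 0"]) (simp_all add: True norm_quat_def quat_eq_iff power2_eq_square)
next
  case False
  define r where "r = norm (1 + u)"
  have "1 + u \<noteq> 0"
    using False by (metis add.inverse_inverse add_eq_0_iff)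
  then have r: "r \<noteq> 0" by (simp add: r_def)
  have "r\<^sup>2 = 2 + 2 * qRe u"
    using quat_norm_sq[of u] assms by (simp add: r_def quat_norm_sq) algebra
  then have "(1 + u) * (1 + u) = r\<^sup>2 *\<^sub>R u"
    using quat_square[of u] assms by (simp add: algebra_simps scaleR_2)
  then have "(inverse r *\<^sub>R (1 + u))\<^sup>2 = ((inverse r)\<^sup>2 * r\<^sup>2) *\<^sub>R u"
    by (simp add: power2_eq_square)
  also have "\<dots> = u"
    using r by (simp flip: power_mult_distrib)
  finally have "(inverse r *\<^sub>R (1 + u))\<^sup>2 = u" .
  moreover have "norm (inverse r *\<^sub>R (1 + u)) = 1"
    using r by (simp add: r_def)
  ultimately show thesis by (rule that[rotated])
qed

text \<open>The two equations say \<open>(q - a) * (q - b) = (q - b') * (q - a')\<close>. The new left root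
  \<open>b'\<close> must be a zero of the product; substituting the quadratic equation of \<open>b\<close> for
  \<open>b'^2\<close> turns this into \<open>b' (b\<^sup>* - a) = (b\<^sup>* - a) b\<close>, where \<open>b\<^sup>*\<close> is the conjugate of \<open>b\<close>,
  and so \<open>b'\<close> is a conjugate of \<open>b\<close> by \<open>b\<^sup>* - a\<close>.\<close>

lemma quat_linear_factors_swap:
  fixes a b :: quat
  obtains a' b' where "norm a' = norm a" "norm b' = norm b" "b' + a' = a + b" "b' * a' = a * b"
proof -
  define bc where "bc = (2 * qRe b) *\<^sub>R 1 - b"
  have bc: "bc * b = (norm b)\<^sup>2 *\<^sub>R 1" "b * bc = (norm b)\<^sup>2 *\<^sub>R 1"
    using quat_square[of b] by (simp_all add: bc_def algebra_simps)
  show thesis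
  proof (cases "a = bc")
    case True
    \<comment> \<open>The product is then \<open>(q - b\<^sup>*) * (q - b)\<close>, whose coefficients are real.\<close>
    have "norm bc = norm b"
      by (simp add: bc_def norm_quat_def)
    with True bc show thesis
      by (intro that[of b a]) simp_all
  next
    case False
    define c where "c = bc - a"
    have c: "c \<noteq> 0" using False by (simp add: c_def)
    define x where "x = c * b * inverse c"
    have xc: "x * c = c * b"
      using c by (simp add: x_def mult.assoc)
    have nx: "norm x = norm b"
      using c by (simp add: x_def norm_mult norm_inverse)
    have "x * x = c * (b * b) * inverse c"
      using c by (simp add: x_def mult.assoc) (simp flip: mult.assoc)
    also have "\<dots> = (2 * qRe b) *\<^sub>R x - (norm b)\<^sup>2 *\<^sub>R 1"
      using c by (simp add: quat_square x_def algebra_simps)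
    finally have xx: "x * x = (2 * qRe b) *\<^sub>R x - (norm b)\<^sup>2 *\<^sub>R 1" .
    have "x * (a + b - x) = a * b + (c * b - x * c) + ((2 * qRe b) *\<^sub>R x - x * x) - bc * b"
      by (simp add: c_def bc_def algebra_simps)
    then have prod: "x * (a + b - x) = a * b"
      by (simp add: xc xx bc)
    have "norm (a + b - x) = norm a"
    proof (cases "b = 0")
      case True
      then show ?thesis by (simp add: x_def)
    next
      case False
      from prod have "norm x * norm (a + b - x) = norm a * norm b"
        by (simp flip: norm_mult)
      with False nx show ?thesis by simp
    qed
    with nx prod show thesis
      by (intro that[of "a + b - x" x]) simp_all
  qed
qed

section \<open>Coefficients of a cubic with vanishing sum of roots\<close>

lemma norm_quadratic_coeff_le_outer:
  fixes a b c :: quat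
  assumes "a + b + c = 0" and "norm b \<le> k" and "norm c \<le> k"
  shows "norm (a * b + a * c + b * c) \<le> k\<^sup>2 + (norm a)\<^sup>2"
proof -
  have a: "a = - (b + c)"
    using assms(1) by (simp only: eq_neg_iff_add_eq_0 add.assoc)
  have "a * b + a * c + b * c = b * c - a * a"
    unfolding a by (simp add: algebra_simps)
  also have "norm \<dots> \<le> norm b * norm c + norm a * norm a"
    by (metis norm_mult norm_triangle_ineq4)
  also have "\<dots> \<le> k\<^sup>2 + (norm a)\<^sup>2"
    using assms(2,3) mult_mono[of "norm b" k "norm c" k] norm_ge_zero[of b]
    by (simp add: power2_eq_square order.trans[OF norm_ge_zero assms(2)])
  finally show ?thesis .
qed

text \<open>For the middle root, interchanging the first two factors changes neither the cubic nor
  the norms of its roots, and reduces the claim to the case of an outer root.\<close>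

lemma norm_quadratic_coeff_le:
  fixes a b c :: quat
  assumes sum: "a + b + c = 0"
    and le: "norm a \<le> k" "norm b \<le> k" "norm c \<le> k"
    and s: "s = norm a \<or> s = norm b \<or> s = norm c"
  shows "norm (a * b + a * c + b * c) \<le> k\<^sup>2 + s\<^sup>2"
  using s
proof (elim disjE)
  assume "s = norm a"
  with norm_quadratic_coeff_le_outer[OF sum le(2,3)] show ?thesis by simp
next
  assume "s = norm b"
  obtain a' b' where *: "norm a' = norm a" "norm b' = norm b" "b' + a' = a + b" "b' * a' = a * b"
    by (rule quat_linear_factors_swap)
  have "norm (b' * a' + b' * c + a' * c) \<le> k\<^sup>2 + (norm b')\<^sup>2"
    using * sum le by (intro norm_quadratic_coeff_le_outer) simp_all
  moreover have "b' * a' + b' * c + a' * c = a * b + a * c + b * c"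
    using *(3,4) by (metis add.assoc distrib_right)
  ultimately show ?thesis
    unfolding \<open>s = norm b\<close> *(2) by (simp only:)
next
  assume "s = norm c"
  have c: "c = - (a + b)"
    using sum by (metis add_eq_0_iff)
  have "a * b + a * c + b * c = a * b - c * c"
    unfolding c by (simp add: algebra_simps)
  also have "norm \<dots> \<le> norm a * norm b + norm c * norm c"
    by (metis norm_mult norm_triangle_ineq4)
  also have "\<dots> \<le> k\<^sup>2 + s\<^sup>2"
    using le(1,2) mult_mono[of "norm a" k "norm b" k] norm_ge_zero[of a] \<open>s = norm c\<close>
    by (simp add: power2_eq_square order.trans[OF norm_ge_zero le(1)])
  finally show ?thesis .
qed

lemma norm_constant_coeff_le:
  fixes a b c :: quat
  assumes "norm a \<le> k" "norm b \<le> k" "norm c \<le> k"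
    and "s = norm a \<or> s = norm b \<or> s = norm c"
  shows "norm (a * b * c) \<le> s * k\<^sup>2"
proof -
  have *: "x * (y * z) \<le> x * k\<^sup>2" if "0 \<le> x" "0 \<le> y" "y \<le> k" "0 \<le> z" "z \<le> k" for x y z :: real
    using that by (simp add: power2_eq_square mult_left_mono mult_mono)
  show ?thesis
    using assms(4)
      *[of "norm a" "norm b" "norm c"] *[of "norm b" "norm a" "norm c"] *[of "norm c" "norm a" "norm b"]
      assms(1-3)
    by (auto simp: norm_mult mult_ac)
qed

section \<open>Norms of the cubic and of its derivative\<close>

lemma qeval_eq_sum:
  assumes "\<And>m. m > n \<Longrightarrow> Poly_Mapping.lookup P m = 0"
  shows "qeval P q = (\<Sum>m\<le>n. q ^ m * Poly_Mapping.lookup P m)"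
  unfolding qeval_def
proof (rule sum.mono_neutral_left)
  show "Poly_Mapping.keys P \<subseteq> {..n}"
    using assms by (auto simp: in_keys_iff not_less[symmetric])
qed (auto simp: in_keys_iff)

lemma linear_factors_product3:
  "(qvar - qconst a) * (qvar - qconst b) * (qvar - qconst c) =
    Poly_Mapping.single 3 1 - Poly_Mapping.single 2 (a + b + c)
      + Poly_Mapping.single 1 (a * b + a * c + b * c) - Poly_Mapping.single 0 (a * b * c)"
  by (simp add: qvar_def qconst_def algebra_simps mult_single single_add numeral_2_eq_2 numeral_3_eq_3)

lemma lookup_depressed_cubic:
  fixes P :: qpoly
  assumes "P = Poly_Mapping.single 3 1 + Poly_Mapping.single 1 B - Poly_Mapping.single 0 C"
  shows "Poly_Mapping.lookup P m = (if m = 3 then 1 else if m = 1 then B else if m = 0 then - C else 0)"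
  by (simp add: assms lookup_add lookup_minus lookup_single when_def)

lemma qnorm_depressed_cubic_le:
  fixes P :: qpoly
  assumes P: "P = Poly_Mapping.single 3 1 + Poly_Mapping.single 1 B - Poly_Mapping.single 0 C"
  shows "qnorm P \<le> 1 + norm B + norm C"
proof -
  obtain q where q: "norm q \<le> 1" "norm (qeval P q) = qnorm P"
    using qnorm_attained by blast
  have "qeval P q = q ^ 3 + q * B - C"
    by (subst qeval_eq_sum[of 3])
      (simp_all add: lookup_depressed_cubic[OF P] numeral_3_eq_3)
  also have "norm \<dots> \<le> norm q ^ 3 + norm q * norm B + norm C"
    by (intro order.trans[OF norm_triangle_ineq4] add_mono order.trans[OF norm_triangle_ineq])
      (simp_all add: norm_mult norm_power)
  also have "\<dots> \<le> 1 + norm B + norm C"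
    using q(1) by (intro add_mono) (simp_all add: power_le_one mult_left_le_one_le)
  finally show ?thesis by (simp add: q(2))
qed

lemma qnorm_qderiv_depressed_cubic_ge:
  fixes P :: qpoly
  assumes P: "P = Poly_Mapping.single 3 1 + Poly_Mapping.single 1 B - Poly_Mapping.single 0 C"
  shows "3 + norm B \<le> qnorm (qderiv P)"
proof -
  \<comment> \<open>For \<open>B = 0\<close> any direction will do.\<close>
  define u where "u = (if B = 0 then 1 else B /\<^sub>R norm B)"
  have u: "norm u = 1" "B = norm B *\<^sub>R u"
    by (simp_all add: u_def)
  obtain q where q: "norm q = 1" "q\<^sup>2 = u"
    using unit_quat_sqrt[OF u(1)] .
  have "qeval (qderiv P) q = q\<^sup>2 * 3 + B"
    by (subst qeval_eq_sum[of 2])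
      (simp_all add: lookup_qderiv lookup_depressed_cubic[OF P] numeral_2_eq_2 numeral_3_eq_3)
  also have "q\<^sup>2 * 3 = 3 *\<^sub>R u"
    unfolding q(2) by (metis mult.right_neutral mult_scaleR_right of_real_def of_real_numeral)
  also have "3 *\<^sub>R u + B = (3 + norm B) *\<^sub>R u"
    using u(2) by (simp add: scaleR_add_left)
  finally have "norm (qeval (qderiv P) q) = 3 + norm B"
    by (simp add: u(1))
  then show ?thesis
    using qnorm_attained[of "qderiv P"] q(1) by (metis order_refl)
qed

section \<open>The bound on the small root\<close>

text \<open>For \<open>1 \<le> k^3 < 2\<close> the constant term of the quadratic is not positive, so its
  discriminant is not negative and \<open>A_bound k\<close> is a genuine root. Since all powers of the
  unknown have nonnegative coefficients, the quadratic stays below its value at this root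
  for all nonnegative \<open>s\<close> up to it.\<close>

lemma A_bound_quadratic_le:
  assumes k: "1 \<le> k" "k ^ 3 < 2" and s: "0 \<le> s" "s \<le> A_bound k"
  shows "(2 - k ^ 3) * (k\<^sup>2 + s\<^sup>2) + 3 * (s * k\<^sup>2) \<le> 3 * k ^ 3"
proof -
  define d where "d = 2 - k ^ 3"
  define D where "D = 9 * k ^ 4 - 4 * d * (d * k\<^sup>2 - 3 * k ^ 3)"
  define A where "A = A_bound k"
  have d: "0 < d" "d \<le> 1"
    using k one_le_power[of k 3] by (simp_all add: d_def)
  have "d * k\<^sup>2 \<le> 1 * k\<^sup>2"
    using d by (intro mult_right_mono) auto
  also have "1 * k\<^sup>2 \<le> k ^ 3"
    using k by (simp add: power_increasing)
  finally have "d * k\<^sup>2 - 3 * k ^ 3 \<le> 0"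
    using k zero_le_power[of k 3] by linarith
  then have "0 \<le> D"
    using d mult_nonneg_nonpos[of "4 * d" "d * k\<^sup>2 - 3 * k ^ 3"]
    by (auto simp: D_def intro: order.trans[of _ 0])
  moreover have "sqrt D = 2 * d * A + 3 * k\<^sup>2"
    using d by (simp add: A_def A_bound_def D_def d_def field_simps)
  ultimately have "(2 * d * A + 3 * k\<^sup>2)\<^sup>2 = D"
    by (metis real_sqrt_pow2)
  then have "4 * d * (d * A\<^sup>2 + 3 * k\<^sup>2 * A + d * k\<^sup>2 - 3 * k ^ 3) = 0"
    unfolding D_def by algebra
  then have root: "d * A\<^sup>2 + 3 * k\<^sup>2 * A + d * k\<^sup>2 - 3 * k ^ 3 = 0"
    using d by simp
  have "d * s\<^sup>2 \<le> d * A\<^sup>2" "3 * k\<^sup>2 * s \<le> 3 * k\<^sup>2 * A"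
    using s d by (auto simp: A_def power_mono mult_left_mono)
  with root show ?thesis
    by (simp add: d_def algebra_simps)
qed

section \<open>The reverse Bernstein inequality\<close>

theorem theorem3p2:
  fixes \<alpha> \<beta> \<gamma> :: quat and P :: qpoly and k :: real
  assumes "P = (qvar - qconst \<alpha>) * (qvar - qconst \<beta>) * (qvar - qconst \<gamma>)"
    and "norm \<alpha> \<le> k" and "norm \<beta> \<le> k" and "norm \<gamma> \<le> k"
    and "\<alpha> + \<beta> + \<gamma> = 0"
    and "norm \<alpha> \<le> A_bound k \<or> norm \<beta> \<le> A_bound k \<or> norm \<gamma> \<le> A_bound k"
    and "k \<ge> 1"
  shows "qnorm (qderiv P) \<ge> 3 / (1 + k^3) * qnorm P"
proof -
  define B where "B = \<alpha> * \<beta> + \<alpha> * \<gamma> + \<beta> * \<gamma>"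
  define C where "C = \<alpha> * \<beta> * \<gamma>"
  have P: "P = Poly_Mapping.single 3 1 + Poly_Mapping.single 1 B - Poly_Mapping.single 0 C"
    using assms(1,5) by (simp add: linear_factors_product3 B_def C_def)
  obtain s where s: "s = norm \<alpha> \<or> s = norm \<beta> \<or> s = norm \<gamma>" and sA: "s \<le> A_bound k"
    using assms(6) by blast
  have s0: "0 \<le> s" "s \<le> k"
    using s assms(2-4) by auto
  have B: "norm B \<le> k\<^sup>2 + s\<^sup>2"
    unfolding B_def by (rule norm_quadratic_coeff_le[OF assms(5,2,3,4) s])
  have C: "norm C \<le> s * k\<^sup>2"
    unfolding C_def by (rule norm_constant_coeff_le[OF assms(2-4) s])
  have k3: "1 \<le> k ^ 3"
    using assms(7) by simp
  have "(2 - k ^ 3) * norm B + 3 * norm C \<le> 3 * k ^ 3"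
  proof (cases "k ^ 3 < 2")
    case True
    have "(2 - k ^ 3) * norm B \<le> (2 - k ^ 3) * (k\<^sup>2 + s\<^sup>2)"
      using True B by (intro mult_left_mono) auto
    with A_bound_quadratic_le[OF assms(7) True s0(1) sA] C show ?thesis
      by linarith
  next
    case False
    then have "(2 - k ^ 3) * norm B \<le> 0"
      by (intro mult_nonpos_nonneg) auto
    moreover have "s * k\<^sup>2 \<le> k ^ 3"
      using mult_right_mono[OF s0(2), of "k\<^sup>2"] by (simp add: power3_eq_cube power2_eq_square)
    ultimately show ?thesis
      using C by linarith
  qed
  then have le: "3 * (1 + norm B + norm C) \<le> (1 + k ^ 3) * (3 + norm B)"
    by (simp add: algebra_simps)
  have "3 * qnorm P \<le> 3 * (1 + norm B + norm C)"
    using qnorm_depressed_cubic_le[OF P] by simp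
  also have "\<dots> \<le> (1 + k ^ 3) * (3 + norm B)"
    by (rule le)
  also have "\<dots> \<le> (1 + k ^ 3) * qnorm (qderiv P)"
    using qnorm_qderiv_depressed_cubic_ge[OF P] k3 by (intro mult_left_mono) auto
  finally have "3 * qnorm P \<le> (1 + k ^ 3) * qnorm (qderiv P)" .
  then show ?thesis
    using k3 by (simp add: field_simps)
qed

end
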